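(* There is no germ of quasi-reflection map $f\colon(\mathbb C^n,0)\to(\mathbb C^p,0)$ with normal crossings and $\operatorname{rank} G>2(p-n)+1$.
   Context: Let $V$ be a $p$-dimensional complex vector space with a fixed positive definite hermitian form. A reflection on $V$ is a unitary linear map of finite order whose fixed space (its reflecting hyperplane) has dimension $\dim V-1$. A reflection group is a finite subgroup $G\le\mathrm U(V)$ generated by reflections. The rank of $G$ is the dimension of the span of the orthogonal complements of the reflecting hyperplanes of all reflections in $G$. By Shephard--Todd, $\mathbb C[V]^G$ is generated by $p$ homogeneous algebraically independent polynomials $\omega_1,\dots,\omega_p$; the orbit map of $G$ is $\omega=(\omega_1,\dots,\omega_p)\colon V\to\mathbb C^p$. A germ of quasi-reflection map is a germ $f=\omega\circ h\colon(\mathbb C^n,0)\to(\mathbb C^p,0)$, where $h\colon(\mathbb C^n,0)\to(V,0)$ is a finite holomorphic map-germ and $\omega$ is the orbit map of a reflection group $G$ on $V$. For a set $Z$ and $k\ge2$ let $\Delta(Z,k)=\{(z^{(1)},\dots,z^{(k)})\in Z^k\mid z^{(1)}=\dots=z^{(k)}\}$ and $Z^{(k)}=\{(z^{(1)},\dots,z^{(k)})\in Z^k\mid z^{(i)}\ne z^{(j)}\text{ for all }i\neq j\}$. A map $f\colon X\to Y$ of complex manifolds has normal crossings if, for every $k\ge2$, the restriction of $f\times\dots\times f$ ($k$ factors) to $X^{(k)}$ is transverse to $\Delta(Y,k)$. A germ has normal crossings if it has a representative with normal crossings. *)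

theory Defs
  imports "HOL-Analysis.Analysis" "HOL-Algebra.Generated_Groups"
begin

section \<open>Reflection groups\<close>

text \<open>
  The space \<open>V\<close> is coordinatised as \<open>complex ^ 'p\<close>, but carries an arbitrary positive definite
  hermitian form \<open>H\<close>, not necessarily the standard one. Linearity always means complex linearity,
  i.e. linearity for the scalar multiplication \<open>(*s)\<close>; likewise \<open>vec.dim\<close> and \<open>vec.span\<close>
  are the complex dimension and span.
\<close>

abbreviation clinear_map :: "(complex ^ 'a \<Rightarrow> complex ^ 'b) \<Rightarrow> bool" where
  "clinear_map \<equiv> Vector_Spaces.linear (*s) (*s)"

abbreviation clinear_form :: "(complex ^ 'a \<Rightarrow> complex) \<Rightarrow> bool" where
  "clinear_form \<equiv> Vector_Spaces.linear (*s) (*)"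

definition pos_def_hermitian :: "(complex ^ 'p \<Rightarrow> complex ^ 'p \<Rightarrow> complex) \<Rightarrow> bool" where
  "pos_def_hermitian H \<longleftrightarrow>
     (\<forall>w. clinear_form (\<lambda>v. H v w)) \<and>
     (\<forall>v w. H w v = cnj (H v w)) \<and>
     (\<forall>v. v \<noteq> 0 \<longrightarrow> Re (H v v) > 0)"

definition unitary_map ::
    "(complex ^ 'p \<Rightarrow> complex ^ 'p \<Rightarrow> complex) \<Rightarrow> (complex ^ 'p \<Rightarrow> complex ^ 'p) \<Rightarrow> bool" where
  "unitary_map H g \<longleftrightarrow> clinear_map g \<and> (\<forall>v w. H (g v) (g w) = H v w)"

definition unitary_group ::
    "(complex ^ 'p \<Rightarrow> complex ^ 'p \<Rightarrow> complex) \<Rightarrow> (complex ^ 'p \<Rightarrow> complex ^ 'p) monoid" where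
  "unitary_group H = \<lparr>carrier = {g. unitary_map H g}, monoid.mult = (\<circ>), one = id\<rparr>"

definition fixed_space :: "(complex ^ 'p \<Rightarrow> complex ^ 'p) \<Rightarrow> (complex ^ 'p) set" where
  "fixed_space g = {v. g v = v}"

definition is_reflection ::
    "(complex ^ 'p \<Rightarrow> complex ^ 'p \<Rightarrow> complex) \<Rightarrow> (complex ^ 'p \<Rightarrow> complex ^ 'p) \<Rightarrow> bool" where
  "is_reflection H s \<longleftrightarrow>
     unitary_map H s \<and> (\<exists>m>0. s ^^ m = id) \<and> vec.dim (fixed_space s) + 1 = CARD('p)"

definition reflection_group ::
    "(complex ^ 'p \<Rightarrow> complex ^ 'p \<Rightarrow> complex) \<Rightarrow> (complex ^ 'p \<Rightarrow> complex ^ 'p) set \<Rightarrow> bool" where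
  "reflection_group H G \<longleftrightarrow>
     subgroup G (unitary_group H) \<and> finite G \<and>
     (\<exists>S. (\<forall>s\<in>S. is_reflection H s) \<and> G = generate (unitary_group H) S)"

definition orth_compl ::
    "(complex ^ 'p \<Rightarrow> complex ^ 'p \<Rightarrow> complex) \<Rightarrow> (complex ^ 'p) set \<Rightarrow> (complex ^ 'p) set" where
  "orth_compl H W = {v. \<forall>w\<in>W. H v w = 0}"

definition reflection_rank ::
    "(complex ^ 'p \<Rightarrow> complex ^ 'p \<Rightarrow> complex) \<Rightarrow> (complex ^ 'p \<Rightarrow> complex ^ 'p) set \<Rightarrow> nat" where
  "reflection_rank H G =
     vec.dim (vec.span (\<Union>s\<in>{s\<in>G. is_reflection H s}. orth_compl H (fixed_space s)))"

lemma group_unitary_group: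
  fixes H :: "complex ^ 'p \<Rightarrow> complex ^ 'p \<Rightarrow> complex"
  assumes H: "pos_def_hermitian H"
  shows "group (unitary_group H)"
proof (rule groupI)
  show "g \<otimes>\<^bsub>unitary_group H\<^esub> h \<in> carrier (unitary_group H)"
    if "g \<in> carrier (unitary_group H)" "h \<in> carrier (unitary_group H)" for g h
    using that by (auto simp: unitary_group_def unitary_map_def intro: Vector_Spaces.linear_compose)
  show "\<one>\<^bsub>unitary_group H\<^esub> \<in> carrier (unitary_group H)"
    by (auto simp: unitary_group_def unitary_map_def vec.linear_id)
next
  fix g assume "g \<in> carrier (unitary_group H)"
  then have lin: "clinear_map g" and pres: "\<And>v w. H (g v) (g w) = H v w"
    by (auto simp: unitary_group_def unitary_map_def)
  have "v = 0" if "g v = 0" for v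
  proof (rule ccontr)
    assume "v \<noteq> 0"
    moreover have "H v v = H 0 0" using pres[of v v] that by simp
    moreover from H have "clinear_form (\<lambda>v. H v 0)"
      unfolding pos_def_hermitian_def by blast
    then have "H 0 0 = 0"
      using Vector_Spaces.linear.axioms(3) module_hom.zero by blast
    moreover from H \<open>v \<noteq> 0\<close> have "Re (H v v) > 0"
      unfolding pos_def_hermitian_def by blast
    ultimately show False by simp
  qed
  then have inj: "inj g"
    using module_hom.inj_iff_eq_0[OF Vector_Spaces.linear.axioms(3)[OF lin]] by blast
  obtain g' where g': "clinear_map g'" "g' \<circ> g = id"
    using vec.linear_injective_left_inverse[OF lin inj] by blast
  have "g \<circ> g' = id"
    using vec.linear_inverse_left[OF lin g'(1)] g'(2) by blast
  then have "unitary_map H g'"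
    unfolding unitary_map_def using g'(1) pres by (metis comp_apply id_apply)
  then show "\<exists>y\<in>carrier (unitary_group H). y \<otimes>\<^bsub>unitary_group H\<^esub> g = \<one>\<^bsub>unitary_group H\<^esub>"
    using g'(2) by (auto simp: unitary_group_def)
qed (auto simp: unitary_group_def)


section \<open>Invariants and orbit maps\<close>

text \<open>The algebra of functions generated over the complex numbers by a set of functions.\<close>

inductive_set algebra_generated :: "('v \<Rightarrow> complex) set \<Rightarrow> ('v \<Rightarrow> complex) set"
  for S :: "('v \<Rightarrow> complex) set" where
  const: "(\<lambda>_. c) \<in> algebra_generated S"
| gen: "P \<in> S \<Longrightarrow> P \<in> algebra_generated S"
| add: "P \<in> algebra_generated S \<Longrightarrow> Q \<in> algebra_generated S \<Longrightarrow>
          (\<lambda>v. P v + Q v) \<in> algebra_generated S"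
| mult: "P \<in> algebra_generated S \<Longrightarrow> Q \<in> algebra_generated S \<Longrightarrow>
          (\<lambda>v. P v * Q v) \<in> algebra_generated S"

text \<open>
  The coordinate ring \<open>\<complex>[V]\<close>, as the algebra of polynomial functions, which is generated by the dual
  space. Since the complex numbers are infinite, a polynomial is determined by its function.
\<close>

definition polynomial_functions :: "(complex ^ 'p \<Rightarrow> complex) set" where
  "polynomial_functions = algebra_generated {L. clinear_form L}"

definition invariant_polynomials ::
    "(complex ^ 'p \<Rightarrow> complex ^ 'p) set \<Rightarrow> (complex ^ 'p \<Rightarrow> complex) set" where
  "invariant_polynomials G = {P \<in> polynomial_functions. \<forall>g\<in>G. \<forall>v. P (g v) = P v}"

definition homogeneous_polynomial :: "nat \<Rightarrow> (complex ^ 'p \<Rightarrow> complex) \<Rightarrow> bool" where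
  "homogeneous_polynomial d P \<longleftrightarrow>
     P \<in> polynomial_functions \<and> (\<forall>c v. P (c *s v) = c ^ d * P v)"

text \<open>Here \<open>Q\<close> ranges over the polynomials in as many variables as there are functions \<open>\<omega>\<^sub>i\<close>.\<close>

definition algebraically_independent :: "('v \<Rightarrow> complex ^ 'p) \<Rightarrow> bool" where
  "algebraically_independent \<omega> \<longleftrightarrow>
     (\<forall>Q\<in>polynomial_functions. (\<forall>v. Q (\<omega> v) = 0) \<longrightarrow> Q = (\<lambda>_. 0))"

definition orbit_map ::
    "(complex ^ 'p \<Rightarrow> complex ^ 'p) set \<Rightarrow> (complex ^ 'p \<Rightarrow> complex ^ 'p) \<Rightarrow> bool" where
  "orbit_map G \<omega> \<longleftrightarrow>
     (\<forall>i. \<exists>d. homogeneous_polynomial d (\<lambda>v. \<omega> v $ i)) \<and>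
     algebraically_independent \<omega> \<and>
     algebra_generated (range (\<lambda>i v. \<omega> v $ i)) = invariant_polynomials G"


section \<open>Germs of holomorphic maps\<close>

text \<open>
  A map germ at \<open>0\<close> is represented by a total function, of which only the values near \<open>0\<close> matter.
\<close>

definition holomorphic_map_on :: "(complex ^ 'n \<Rightarrow> complex ^ 'p) \<Rightarrow> (complex ^ 'n) set \<Rightarrow> bool" where
  "holomorphic_map_on f U \<longleftrightarrow>
     (\<forall>x\<in>U. \<exists>f'. clinear_map f' \<and> (f has_derivative f') (at x))"

definition holomorphic_representative ::
    "(complex ^ 'n \<Rightarrow> complex ^ 'p) \<Rightarrow> (complex ^ 'n) set \<Rightarrow> (complex ^ 'n \<Rightarrow> complex ^ 'p) \<Rightarrow> bool" where
  "holomorphic_representative g U f \<longleftrightarrow>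
     open U \<and> 0 \<in> U \<and> holomorphic_map_on g U \<and> (\<forall>\<^sub>F z in nhds 0. g z = f z)"

definition finite_map :: "('a::topological_space) set \<Rightarrow> ('b::topological_space) set \<Rightarrow> ('a \<Rightarrow> 'b) \<Rightarrow> bool" where
  "finite_map U W h \<longleftrightarrow>
     h ` U \<subseteq> W \<and> closed_map (top_of_set U) (top_of_set W) h \<and> (\<forall>y\<in>W. finite {x\<in>U. h x = y})"

definition finite_holomorphic_germ :: "(complex ^ 'n \<Rightarrow> complex ^ 'p) \<Rightarrow> bool" where
  "finite_holomorphic_germ h \<longleftrightarrow>
     h 0 = 0 \<and>
     (\<exists>U W h1. holomorphic_representative h1 U h \<and> open W \<and> finite_map U W h1)"

definition quasi_reflection_germ ::
    "(complex ^ 'p \<Rightarrow> complex ^ 'p \<Rightarrow> complex) \<Rightarrow> (complex ^ 'p \<Rightarrow> complex ^ 'p) set \<Rightarrow>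
     (complex ^ 'p \<Rightarrow> complex ^ 'p) \<Rightarrow> (complex ^ 'n \<Rightarrow> complex ^ 'p) \<Rightarrow>
     (complex ^ 'n \<Rightarrow> complex ^ 'p) \<Rightarrow> bool" where
  "quasi_reflection_germ H G \<omega> h f \<longleftrightarrow>
     pos_def_hermitian H \<and> reflection_group H G \<and> orbit_map G \<omega> \<and>
     finite_holomorphic_germ h \<and> (\<forall>\<^sub>F z in nhds 0. f z = \<omega> (h z))"


section \<open>Normal crossings\<close>

text \<open>The power \<open>Z\<^sup>k\<close> consists of the extensional functions from \<open>{..<k}\<close> to \<open>Z\<close>.\<close>

definition cart_power :: "'a set \<Rightarrow> nat \<Rightarrow> (nat \<Rightarrow> 'a) set" where
  "cart_power Z k = {..<k} \<rightarrow>\<^sub>E Z"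

definition small_diagonal :: "'a set \<Rightarrow> nat \<Rightarrow> (nat \<Rightarrow> 'a) set" where
  "small_diagonal Z k = {z \<in> cart_power Z k. \<forall>i<k. \<forall>j<k. z i = z j}"

definition distinct_power :: "'a set \<Rightarrow> nat \<Rightarrow> (nat \<Rightarrow> 'a) set" where
  "distinct_power Z k = {z \<in> cart_power Z k. \<forall>i<k. \<forall>j<k. i \<noteq> j \<longrightarrow> z i \<noteq> z j}"

definition power_map :: "nat \<Rightarrow> ('a \<Rightarrow> 'b) \<Rightarrow> (nat \<Rightarrow> 'a) \<Rightarrow> (nat \<Rightarrow> 'b)" where
  "power_map k f z = (\<lambda>i\<in>{..<k}. f (z i))"

definition power_differential ::
    "nat \<Rightarrow> ('a::real_normed_vector \<Rightarrow> 'b::real_normed_vector) \<Rightarrow> (nat \<Rightarrow> 'a) \<Rightarrow> (nat \<Rightarrow> 'a) \<Rightarrow> (nat \<Rightarrow> 'b)"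
  where "power_differential k f z u = (\<lambda>i\<in>{..<k}. frechet_derivative f (at (z i)) (u i))"

text \<open>
  Transversality of the restriction of \<open>f \<times> \<dots> \<times> f\<close> to the open subset \<open>U\<^sup>(\<^sup>k\<^sup>)\<close> of \<open>U\<^sup>k\<close> to the diagonal
  \<open>\<Delta>(Y,k)\<close> for \<open>Y = complex ^ 'p\<close>: over each point of the diagonal, the image of the differential
  and the tangent space of the diagonal together span the tangent space \<open>Y\<^sup>k\<close>. The diagonal is a
  linear subspace, hence is its own tangent space.
\<close>

definition transverse_to_diagonal ::
    "nat \<Rightarrow> (complex ^ 'n) set \<Rightarrow> (complex ^ 'n \<Rightarrow> complex ^ 'p) \<Rightarrow> bool" where
  "transverse_to_diagonal k U f \<longleftrightarrow>
     (\<forall>z\<in>distinct_power U k. power_map k f z \<in> small_diagonal UNIV k \<longrightarrow>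
        {(\<lambda>i\<in>{..<k}. a i + b i) | a b.
            a \<in> power_differential k f z ` cart_power UNIV k \<and> b \<in> small_diagonal UNIV k}
        = cart_power UNIV k)"

definition normal_crossings_on :: "(complex ^ 'n) set \<Rightarrow> (complex ^ 'n \<Rightarrow> complex ^ 'p) \<Rightarrow> bool" where
  "normal_crossings_on U f \<longleftrightarrow> (\<forall>k\<ge>2. transverse_to_diagonal k U f)"

definition germ_normal_crossings :: "(complex ^ 'n \<Rightarrow> complex ^ 'p) \<Rightarrow> bool" where
  "germ_normal_crossings f \<longleftrightarrow>
     (\<exists>g U. holomorphic_representative g U f \<and> normal_crossings_on U g)"

end

theory Submission
  imports Defs "HOL-Complex_Analysis.Conformal_Mappings"
begin

text \<open>
  Write \<open>f = \<omega> \<circ> h\<close> and \<open>r = rank G\<close>, and suppose \<open>r > 2(p - n) + 1\<close>. On a mirror (the hyperplane fixed by a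
  reflection of \<open>G\<close>) the derivative of
  \<open>\<omega>\<close> is not onto. If \<open>h x\<close> lies on a mirror and \<open>h x' = g (h x)\<close> for some \<open>g \<in> G\<close>, then \<open>f x = f x'\<close>, and the
  images of the derivatives of \<open>f\<close> at \<open>x\<close> and \<open>x'\<close> both lie in the range of the derivative of \<open>\<omega>\<close> at \<open>h x\<close>.
  With normal crossings these images must span the target whenever \<open>x \<noteq> x'\<close>; so \<open>x = x'\<close>
  (\<open>double_point_off_mirrors\<close>).

  On the other hand such pairs are plentiful. An element \<open>g \<in> G\<close> whose fixed space has least dimension fixes
  only the vectors common to all mirrors, and so it fixes no nonzero vector in the span of the roots. Intersecting this
  span with a mirror gives a subspace \<open>K\<close> of dimension at least \<open>r - 1\<close> that meets the fixed space of \<open>g\<close> only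
  in \<open>0\<close> (\<open>moved_subspace_of_hyperplane\<close>). The pairs \<open>(x, x')\<close> with \<open>(h x', h x)\<close> in the graph of \<open>g\<close>
  over \<open>K\<close> satisfy at most \<open>2p - (r - 1) < 2n\<close> equations in \<open>2n\<close> unknowns, so the origin is not an isolated
  solution. But every solution near the origin has \<open>x = x'\<close>, hence \<open>g\<close> fixes \<open>h x \<in> K\<close>, hence \<open>h x = 0\<close>, hence
  \<open>x = 0\<close> because \<open>h\<close> is finite: a contradiction.

  The analytic input is that fewer than \<open>N\<close> holomorphic equations in \<open>N\<close> unknowns have no isolated solution
  (\<open>no_isolated_point_in_preimage_of_subspace\<close>). It is derived from a minimum modulus principle for nowhere
  vanishing holomorphic maps between spaces of equal dimension (\<open>minimum_modulus_principle\<close>), which in turn is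
  reduced to functions of one variable along a suitable complex line.
\<close>

section \<open>A minimum modulus principle in several variables\<close>

lemma no_strict_min_modulus:
  assumes p: "p holomorphic_on ball 0 \<rho>" and "0 < \<rho>"
    and gt: "\<And>s. s \<in> ball 0 \<rho> \<Longrightarrow> s \<noteq> 0 \<Longrightarrow> cmod (p 0) < cmod (p s)"
  shows "p 0 = 0"
proof (rule ccontr)
  assume p0: "p 0 \<noteq> 0"
  have nz: "p s \<noteq> 0" if "s \<in> ball 0 \<rho>" for s
    using gt[OF that] p0 by (cases "s = 0") auto
  have "(\<lambda>s. inverse (p s)) constant_on ball 0 \<rho>"
  proof (rule maximum_modulus_principle[where U = "ball 0 \<rho>" and \<xi> = 0])
    show "(\<lambda>s. inverse (p s)) holomorphic_on ball 0 \<rho>"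
      using p nz by (intro holomorphic_intros) auto
    show "cmod (inverse (p s)) \<le> cmod (inverse (p 0))" if "s \<in> ball 0 \<rho>" for s
    proof (cases "s = 0")
      case False
      then show ?thesis
        using gt[OF that] p0 by (simp add: norm_inverse le_imp_inverse_le)
    qed simp
  qed (use \<open>0 < \<rho>\<close> in auto)
  then obtain c where c: "\<And>s. s \<in> ball 0 \<rho> \<Longrightarrow> inverse (p s) = c"
    unfolding constant_on_def by blast
  define s where "s = complex_of_real (\<rho> / 2)"
  have s: "s \<in> ball 0 \<rho>" "s \<noteq> 0" "0 \<in> ball 0 \<rho>"
    using \<open>0 < \<rho>\<close> by (auto simp: s_def)
  have "inverse (p s) = inverse (p 0)"
    using c s by simp
  then show False
    using gt[OF s(1,2)] by simp
qed

definition herm :: "complex ^ 'n \<Rightarrow> complex ^ 'n \<Rightarrow> complex" where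
  "herm x y = (\<Sum>i\<in>UNIV. x $ i * cnj (y $ i))"

lemma norm_vec_square: "(norm (x :: complex ^ 'n))\<^sup>2 = (\<Sum>i\<in>UNIV. (cmod (x $ i))\<^sup>2)"
  by (simp add: norm_vec_def L2_set_def sum_nonneg)

lemma herm_self: "herm x x = complex_of_real ((norm x)\<^sup>2)"
  unfolding herm_def norm_vec_square of_real_sum
  by (rule sum.cong) (simp_all only: complex_norm_square)

lemma norm_add_square:
  "(norm (x + y :: complex ^ 'n))\<^sup>2 = (norm x)\<^sup>2 + 2 * Re (herm x y) + (norm y)\<^sup>2"
proof -
  have "(cmod (a + b))\<^sup>2 = (cmod a)\<^sup>2 + 2 * Re (a * cnj b) + (cmod b)\<^sup>2" for a b
    unfolding cmod_power2 by (simp add: power2_eq_square algebra_simps)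
  then show ?thesis
    unfolding norm_vec_square herm_def Re_sum sum_distrib_left
    by (simp add: sum.distrib)
qed

lemma herm_scale_left: "herm (c *s x) y = c * herm x y"
  and herm_diff_left: "herm (x - x') y = herm x y - herm x' y"
  by (simp_all add: herm_def sum_distrib_left sum_subtractf algebra_simps)

lemma herm_commute: "herm y x = cnj (herm x y)"
  by (simp add: herm_def mult.commute)

lemma norm_vec_scale: "norm (c *s (x :: complex ^ 'n)) = cmod c * norm x"
proof -
  have "(norm (c *s x))\<^sup>2 = (cmod c * norm x)\<^sup>2"
    by (simp add: norm_vec_square norm_mult power_mult_distrib sum_distrib_left)
  then show ?thesis
    by (simp add: power2_eq_iff_nonneg)
qed

text \<open>
  Pythagoras for the component of \<open>x\<close> along \<open>w\<close> and the remainder orthogonal to \<open>w\<close>. Orthogonality is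
  what makes the remainder enter quadratically below.
\<close>

lemma norm_decomposition:
  fixes w x :: "complex ^ 'm"
  assumes "w \<noteq> 0"
  defines "p \<equiv> herm x w / herm w w"
  shows "(norm x)\<^sup>2 = (norm w)\<^sup>2 * (cmod p)\<^sup>2 + (norm (x - p *s w))\<^sup>2"
proof -
  have "herm (x - p *s w) w = 0"
    using assms by (simp add: herm_diff_left herm_scale_left herm_self)
  then have "herm (p *s w) (x - p *s w) = 0"
    by (simp add: herm_scale_left herm_commute[of w "x - p *s w"])
  then show ?thesis
    using norm_add_square[of "p *s w" "x - p *s w"]
    by (simp add: norm_vec_scale power_mult_distrib)
qed

lemma bounded_linear_cscale_left: "bounded_linear (\<lambda>s. s *s (v :: complex ^ 'n))"
proof (rule bounded_linear_intro[where K = "norm v"])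
  show "norm (s *s v) \<le> norm s * norm v" for s by (simp add: norm_vec_scale)
qed (simp_all add: vec_eq_iff algebra_simps)

text \<open>
  On the complex line through \<open>q\<close> in the direction \<open>v\<close>, the hypothesis on \<open>F'\<close> says that \<open>F\<close> stays
  parallel to \<open>w = F q\<close> up to an error \<open>R = o(s)\<close>. Hence \<open>\<bar>F\<bar>\<^sup>2\<close> agrees, up to \<open>o(\<bar>s\<bar>\<^sup>2)\<close>, with
  \<open>\<bar>w\<bar>\<^sup>2 \<bar>p\<bar>\<^sup>2\<close> for a holomorphic function \<open>p\<close> of one variable. At a minimum of the weighted square the
  weight contributes a gain of order exactly \<open>\<bar>s\<bar>\<^sup>2\<close>, which beats the error, so that \<open>\<bar>p\<bar>\<close>, corrected by
  an exponential, would have a strict local minimum with a nonzero value.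
\<close>

lemma no_weighted_min_along_line:
  fixes F :: "complex ^ 'n \<Rightarrow> complex ^ 'm"
  assumes U: "open U" "q \<in> U" and F: "holomorphic_map_on F U"
    and F': "(F has_derivative F') (at q)" "F' v = c *s F q"
    and v: "v \<noteq> 0" and "0 < \<delta>"
    and min: "\<And>z. z \<in> U \<Longrightarrow>
      (norm (F q))\<^sup>2 * exp (- \<delta> * (norm q)\<^sup>2) \<le> (norm (F z))\<^sup>2 * exp (- \<delta> * (norm z)\<^sup>2)"
  shows "F q = 0"
proof (rule ccontr)
  define w where "w = F q"
  assume "F q \<noteq> 0"
  then have w: "w \<noteq> 0" by (simp add: w_def)
  define line where "line = (\<lambda>s. q + s *s v)"
  have line: "(line has_derivative (\<lambda>s. s *s v)) (at s)" for s
    unfolding line_def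
    by (auto intro!: derivative_eq_intros bounded_linear_imp_has_derivative
        bounded_linear_cscale_left)
  have line0 [simp]: "line 0 = q" by (simp add: line_def)
  have comp: "((\<lambda>s. F (line s) $ i) has_field_derivative D v $ i) (at s)"
    if "(F has_derivative D) (at (line s))" "clinear_map D" for s i D
  proof -
    have "((\<lambda>s. F (line s)) has_derivative (\<lambda>t. D (t *s v))) (at s)"
      using has_derivative_compose[OF line that(1)] .
    from bounded_linear.has_derivative[OF bounded_linear_vec_nth this]
    have "((\<lambda>s. F (line s) $ i) has_derivative (\<lambda>t. D (t *s v) $ i)) (at s)" .
    moreover have "(\<lambda>t. D (t *s v) $ i) = (*) (D v $ i)"
      by (auto simp: vec.linear_scale[OF that(2)])
    ultimately show ?thesis
      by (simp add: has_field_derivative_def)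
  qed
  have "continuous (at 0) line"
    using line has_derivative_continuous by blast
  then obtain \<rho>0 where \<rho>0: "\<rho>0 > 0" "\<And>s. s \<in> ball 0 \<rho>0 \<Longrightarrow> line s \<in> U"
    using U continuous_at_open[of 0 line] line0
    by (metis open_contains_ball subset_eq)
  define p where "p = (\<lambda>s. herm (F (line s)) w / herm w w)"
  have p0: "p 0 = 1"
    using w by (simp add: p_def w_def[symmetric] herm_self)
  have holF: "(\<lambda>s. F (line s) $ i) holomorphic_on ball 0 \<rho>0" for i
    unfolding holomorphic_on_def
  proof (intro ballI)
    fix s :: complex assume "s \<in> ball 0 \<rho>0"
    then have "line s \<in> U" by (rule \<rho>0)
    then obtain D where "clinear_map D" "(F has_derivative D) (at (line s))"
      using F unfolding holomorphic_map_on_def by blast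
    then show "(\<lambda>s. F (line s) $ i) field_differentiable at s within ball 0 \<rho>0"
      using comp field_differentiable_def field_differentiable_at_within by blast
  qed
  have holp: "p holomorphic_on ball 0 \<rho>0"
    unfolding p_def herm_def divide_inverse
    by (intro holomorphic_intros holF)
  define R where "R = (\<lambda>s. F (line s) - p s *s w)"
  have R0: "R 0 = 0"
    by (simp add: R_def p0 w_def)
  have "clinear_map F'"
    using F F' U has_derivative_unique unfolding holomorphic_map_on_def by blast
  have "(p has_field_derivative (herm (F' v) w / herm w w)) (at 0)"
    unfolding p_def herm_def
    by (rule DERIV_cdivide, rule DERIV_sum, rule DERIV_cmult_right, rule comp)
      (use F' \<open>clinear_map F'\<close> in simp_all)
  then have "(p has_field_derivative c) (at 0)"
    using w F' by (simp add: w_def[symmetric] herm_scale_left herm_self)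
  then have "((\<lambda>s. p s *s w) has_derivative (\<lambda>t. (c * t) *s w)) (at 0)"
    using bounded_linear.has_derivative[OF bounded_linear_cscale_left]
    unfolding has_field_derivative_def by blast
  moreover have "((\<lambda>s. F (line s)) has_derivative (\<lambda>t. F' (t *s v))) (at 0)"
    using has_derivative_compose[OF line[of 0], of F F'] F' by simp
  ultimately have "(R has_derivative (\<lambda>t. F' (t *s v) - (c * t) *s w)) (at 0)"
    unfolding R_def by (rule has_derivative_diff[rotated])
  then have "(R has_derivative (\<lambda>t. 0)) (at 0)"
    using F' by (simp add: vec.linear_scale[OF \<open>clinear_map F'\<close>] w_def mult.commute)
  then have "((\<lambda>h. norm (R h) / norm h) \<longlongrightarrow> 0) (at 0)"
    by (simp add: has_derivative_at R0)
  \<comment> \<open>This slope makes the error \<open>2 \<bar>R\<bar>\<^sup>2\<close> at most half of the gain \<open>\<bar>w\<bar>\<^sup>2 \<delta> \<bar>s\<bar>\<^sup>2 \<bar>v\<bar>\<^sup>2\<close>.\<close>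
  define \<eta> where "\<eta> = sqrt (\<delta> / 4) * norm v * norm w"
  have "\<eta> > 0"
    using \<open>0 < \<delta>\<close> v w by (simp add: \<eta>_def)
  \<comment> \<open>The weight \<open>\<bar>z\<bar>\<^sup>2\<close> at \<open>q + s v\<close> has a linear term \<open>2 Re (s b)\<close>, which has no sign; as the real part
      of a holomorphic function it can be absorbed into \<open>p\<close> through the factor \<open>E\<close>.\<close>
  define b where "b = herm v q"
  define E where "E = (\<lambda>s. exp (- of_real \<delta> * s * b))"
  have "\<forall>\<^sub>F s in at 0. norm (R s) / norm s < \<eta>"
    using \<open>((\<lambda>h. norm (R h) / norm h) \<longlongrightarrow> 0) (at 0)\<close> \<open>\<eta> > 0\<close> by (rule order_tendstoD(2))
  moreover have "\<forall>\<^sub>F s in at 0. (cmod (E s))\<^sup>2 < 2"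
  proof (rule order_tendstoD(2))
    show "((\<lambda>s. (cmod (E s))\<^sup>2) \<longlongrightarrow> 1) (at 0)"
      unfolding E_def by (auto intro!: tendsto_eq_intros)
  qed simp
  ultimately have "\<forall>\<^sub>F s in at 0. norm (R s) / norm s < \<eta> \<and> (cmod (E s))\<^sup>2 < 2"
    by (rule eventually_conj)
  then obtain \<rho>1 where \<rho>1: "\<rho>1 > 0"
    "\<And>s. s \<in> ball 0 \<rho>1 \<Longrightarrow> s \<noteq> 0 \<Longrightarrow> norm (R s) / norm s < \<eta> \<and> (cmod (E s))\<^sup>2 < 2"
    unfolding eventually_at by (auto simp: dist_commute)
  define \<rho> where "\<rho> = min \<rho>0 \<rho>1"
  have "p 0 * E 0 = 0"
  proof (rule no_strict_min_modulus[where \<rho> = \<rho> and p = "\<lambda>s. p s * E s"])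
    have "p holomorphic_on ball 0 \<rho>"
      using holp by (rule holomorphic_on_subset) (auto simp: \<rho>_def)
    then show "(\<lambda>s. p s * E s) holomorphic_on ball 0 \<rho>"
      unfolding E_def by (intro holomorphic_intros)
    show "0 < \<rho>" using \<rho>0 \<rho>1 by (simp add: \<rho>_def)
    fix s :: complex assume s: "s \<in> ball 0 \<rho>" "s \<noteq> 0"
    then have "line s \<in> U" and Rs: "norm (R s) < \<eta> * norm s" and Es: "(cmod (E s))\<^sup>2 < 2"
      using \<rho>0(2)[of s] \<rho>1(2)[of s] by (auto simp: \<rho>_def field_simps)
    have E2: "(cmod (E s))\<^sup>2 = exp (- 2 * \<delta> * Re (s * b))"
      by (simp add: E_def exp_double[symmetric] mult.assoc)
    have "(norm (line s))\<^sup>2 = (norm q)\<^sup>2 + 2 * Re (s * b) + (cmod s)\<^sup>2 * (norm v)\<^sup>2"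
      using norm_add_square[of "s *s v" q]
      by (simp add: line_def b_def herm_scale_left norm_vec_scale power_mult_distrib add.commute)
    then have expo: "- \<delta> * (norm (line s))\<^sup>2
        = - \<delta> * (norm q)\<^sup>2 + (- 2 * \<delta> * Re (s * b) + - \<delta> * (cmod s)\<^sup>2 * (norm v)\<^sup>2)"
      by (simp add: distrib_left del: times_complex.sel)
    have "exp (- \<delta> * (norm (line s))\<^sup>2)
        = exp (- \<delta> * (norm q)\<^sup>2) * ((cmod (E s))\<^sup>2 * exp (- \<delta> * (cmod s)\<^sup>2 * (norm v)\<^sup>2))"
      unfolding E2 expo exp_add ..
    with min[OF \<open>line s \<in> U\<close>]
    have "(norm w)\<^sup>2 \<le> (norm (F (line s)))\<^sup>2 * ((cmod (E s))\<^sup>2 * exp (- \<delta> * (cmod s)\<^sup>2 * (norm v)\<^sup>2))"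
      by (simp add: w_def algebra_simps)
    then have "(norm w)\<^sup>2 * exp (\<delta> * (cmod s)\<^sup>2 * (norm v)\<^sup>2) \<le> (norm (F (line s)))\<^sup>2 * (cmod (E s))\<^sup>2"
      by (simp add: exp_minus field_simps)
    also have "(norm (F (line s)))\<^sup>2 = (norm w)\<^sup>2 * (cmod (p s))\<^sup>2 + (norm (R s))\<^sup>2"
      unfolding p_def R_def by (rule norm_decomposition[OF w])
    finally have 1: "(norm w)\<^sup>2 * exp (\<delta> * (cmod s)\<^sup>2 * (norm v)\<^sup>2)
        \<le> (norm w)\<^sup>2 * (cmod (p s * E s))\<^sup>2 + (norm (R s))\<^sup>2 * (cmod (E s))\<^sup>2"
      by (simp add: norm_mult power_mult_distrib algebra_simps)
    have "(norm (R s))\<^sup>2 < (\<eta> * norm s)\<^sup>2"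
      using Rs by (intro power_strict_mono) auto
    then have "(norm (R s))\<^sup>2 * (cmod (E s))\<^sup>2 \<le> (\<eta> * norm s)\<^sup>2 * 2"
      using Es by (intro mult_mono) auto
    also have "\<dots> = (norm w)\<^sup>2 * (\<delta> * (cmod s)\<^sup>2 * (norm v)\<^sup>2 / 2)"
      using \<open>0 < \<delta>\<close> by (simp add: \<eta>_def power_mult_distrib)
    finally have "(norm w)\<^sup>2 * exp (\<delta> * (cmod s)\<^sup>2 * (norm v)\<^sup>2)
        \<le> (norm w)\<^sup>2 * ((cmod (p s * E s))\<^sup>2 + \<delta> * (cmod s)\<^sup>2 * (norm v)\<^sup>2 / 2)"
      using 1 by (simp add: algebra_simps)
    then have "exp (\<delta> * (cmod s)\<^sup>2 * (norm v)\<^sup>2)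
        \<le> (cmod (p s * E s))\<^sup>2 + \<delta> * (cmod s)\<^sup>2 * (norm v)\<^sup>2 / 2"
      using w by simp
    moreover have "1 + \<delta> * (cmod s)\<^sup>2 * (norm v)\<^sup>2 \<le> exp (\<delta> * (cmod s)\<^sup>2 * (norm v)\<^sup>2)"
      by (rule exp_ge_add_one_self)
    moreover have "\<delta> * (cmod s)\<^sup>2 * (norm v)\<^sup>2 > 0"
      using \<open>0 < \<delta>\<close> s v by simp
    ultimately have "1 < (cmod (p s * E s))\<^sup>2"
      by linarith
    then have "1 < cmod (p s * E s)"
      using power_le_one[of "cmod (p s * E s)" 2] by (meson norm_ge_zero not_le)
    then show "cmod (p 0 * E 0) < cmod (p s * E s)"
      by (simp add: p0 E_def)
  qed
  then show False
    by (simp add: p0 E_def)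
qed

lemma scaleR_eq_complex_scale: "r *\<^sub>R (x :: complex ^ 'n) = complex_of_real r *s x"
  by (simp add: vec_eq_iff) (simp add: scaleR_conv_of_real)

text \<open>
  In equal dimensions a derivative can always be made parallel to a given vector in some nonzero direction:
  either it has a kernel, or it is onto.
\<close>

lemma injective_or_prescribed_image:
  fixes D :: "complex ^ 'n \<Rightarrow> complex ^ 'n"
  assumes D: "clinear_map D" and w: "w \<noteq> 0"
  obtains v c where "v \<noteq> 0" "D v = c *s w"
proof (cases "inj D")
  case True
  then have "surj D"
    using vec.linear_inj_imp_surj[OF D] by blast
  then obtain v where "D v = 1 *s w"
    by (metis surjD)
  moreover from this have "v \<noteq> 0"
    using w vec.linear_0[OF D] by auto
  ultimately show ?thesis using that by blast
next
  case False
  then obtain v where "v \<noteq> 0" "D v = 0 *s w"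
    using vec.linear_inj_iff_eq_0[OF D] by auto
  then show ?thesis using that by blast
qed

text \<open>
  The domain and the target have the same dimension, so at every point some direction satisfies the
  hypothesis on the derivative in \<open>no_weighted_min_along_line\<close>; therefore \<open>\<bar>F\<bar>\<^sup>2 exp (- \<delta> \<bar>z\<bar>\<^sup>2)\<close> has no
  minimum inside the ball, whatever \<open>\<delta> > 0\<close>. If the value at the centre were below the values on the
  sphere, this would remain so after multiplication by the weight of a small \<open>\<delta>\<close>, which is absurd.
\<close>

theorem minimum_modulus_principle:
  fixes F :: "complex ^ 'n \<Rightarrow> complex ^ 'n"
  assumes U: "open U" "cball 0 r \<subseteq> U" and F: "holomorphic_map_on F U"
    and nz: "\<And>z. z \<in> cball 0 r \<Longrightarrow> F z \<noteq> 0"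
    and c: "\<And>z. z \<in> sphere 0 r \<Longrightarrow> c \<le> norm (F z)" and "0 < r"
  shows "c \<le> norm (F 0)"
proof (rule ccontr)
  assume "\<not> c \<le> norm (F 0)"
  then have lt: "norm (F 0) < c" and "0 < c"
    using le_less_trans[OF norm_ge_zero, of "F 0" c] by auto
  have F0: "norm (F 0) > 0"
    using nz[of 0] \<open>0 < r\<close> by simp
  \<comment> \<open>On the sphere the weighted square is then at least \<open>c \<bar>F 0\<bar>\<close>, still above \<open>\<bar>F 0\<bar>\<^sup>2\<close>.\<close>
  define \<delta> where "\<delta> = ln (c / norm (F 0)) / r\<^sup>2"
  have "\<delta> > 0"
    using lt F0 \<open>0 < r\<close> unfolding \<delta>_def by (intro divide_pos_pos ln_gt_zero) auto
  have weight: "exp (- \<delta> * r\<^sup>2) = norm (F 0) / c"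
    using \<open>0 < r\<close> F0 \<open>0 < c\<close> by (simp add: \<delta>_def exp_minus)
  define m where "m = (\<lambda>z. (norm (F z))\<^sup>2 * exp (- \<delta> * (norm z)\<^sup>2))"
  have "isCont F z" if "z \<in> cball 0 r" for z
    using that U F has_derivative_continuous unfolding holomorphic_map_on_def by blast
  then have "continuous_on (cball 0 r) F"
    by (simp add: continuous_at_imp_continuous_on)
  then have "continuous_on (cball 0 r) m"
    unfolding m_def by (intro continuous_intros)
  then obtain q where q: "q \<in> cball 0 r" and qmin: "\<And>z. z \<in> cball 0 r \<Longrightarrow> m q \<le> m z"
    using continuous_attains_inf[of "cball 0 r" m] \<open>0 < r\<close>
    by (metis cball_eq_empty compact_cball less_le_not_le order_less_imp_le not_less)
  have "q \<in> ball 0 r"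
  proof (rule ccontr)
    assume "q \<notin> ball 0 r"
    with q have nq: "norm q = r" by simp
    have "(norm (F 0))\<^sup>2 < c * norm (F 0)"
      using lt F0 by (simp add: power2_eq_square)
    also have "c * norm (F 0) = c\<^sup>2 * exp (- \<delta> * (norm q)\<^sup>2)"
      unfolding nq weight using \<open>0 < c\<close> by (simp add: power2_eq_square)
    also have "\<dots> \<le> m q"
      unfolding m_def using c[of q] nq \<open>0 < c\<close> by (intro mult_right_mono power_mono) auto
    also have "\<dots> \<le> m 0"
      using \<open>0 < r\<close> by (intro qmin) simp
    finally show False by (simp add: m_def)
  qed
  obtain D where D: "clinear_map D" "(F has_derivative D) (at q)"
    using F U q unfolding holomorphic_map_on_def by blast
  obtain v k where v: "v \<noteq> 0" "D v = k *s F q"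
    using injective_or_prescribed_image[OF D(1)] nz[OF q] by blast
  have "F q = 0"
  proof (rule no_weighted_min_along_line[where F = F and q = q and F' = D and v = v and c = k
        and U = "ball 0 r" and \<delta> = \<delta>])
    show "holomorphic_map_on F (ball 0 r)"
      using F U ball_subset_cball unfolding holomorphic_map_on_def by blast
    show "(norm (F q))\<^sup>2 * exp (- \<delta> * (norm q)\<^sup>2) \<le> (norm (F z))\<^sup>2 * exp (- \<delta> * (norm z)\<^sup>2)"
      if "z \<in> ball 0 r" for z
      using qmin[of z] that by (simp add: m_def)
  qed (use \<open>q \<in> ball 0 r\<close> D v \<open>\<delta> > 0\<close> in auto)
  then show False
    using nz q by blast
qed

section \<open>Holomorphic preimages of linear subspaces\<close>

text \<open>
  The codimension of \<open>Q\<close> is the number of linear equations that cut it out; the assumption says that it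
  is smaller than the dimension of the target, which leaves a vector \<open>e\<close> outside the range.
\<close>

lemma linear_map_with_kernel:
  fixes Q :: "(complex ^ 'm) set"
  assumes Q: "vec.subspace Q" and dim: "CARD('m) < vec.dim Q + CARD('n)"
  obtains P :: "complex ^ 'm \<Rightarrow> complex ^ 'n" and e
  where "clinear_map P" "\<And>x. P x = 0 \<longleftrightarrow> x \<in> Q" "e \<notin> range P"
proof -
  obtain B where B: "B \<subseteq> Q" "vec.independent B" "Q \<subseteq> vec.span B" "card B = vec.dim Q"
    using vec.basis_exists by blast
  have spanB: "vec.span B = Q"
    using B Q vec.span_minimal by blast
  define C where "C = vec.extend_basis B - B"
  have ext: "vec.independent (C \<union> B)" "vec.span (C \<union> B) = UNIV"
    using vec.extend_basis_superset[OF B(2)] vec.independent_extend_basis[OF B(2)]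
      vec.span_extend_basis[OF B(2)] by (simp_all add: C_def Un_absorb2)
  have fin: "finite B" "finite C" "C \<inter> B = {}"
    using ext(1) vec.finiteI_independent by (auto simp: C_def)
  have "card C + card B = CARD('m)"
    using vec.dim_span_eq_card_independent[OF ext(1)] ext(2) fin
    by (simp add: card_Un_disjoint card_cart_basis)
  then have cardC: "card C < CARD('n)"
    using dim B(4) by linarith
  obtain \<iota> :: "complex ^ 'm \<Rightarrow> 'n" where \<iota>: "inj_on \<iota> C"
    using card_le_inj[of C "UNIV :: 'n set"] fin cardC by auto
  define f :: "complex ^ 'm \<Rightarrow> complex ^ 'n"
    where "f = (\<lambda>b. if b \<in> C then axis (\<iota> b) 1 else 0)"
  obtain P where P: "clinear_map P" "\<And>b. b \<in> C \<union> B \<Longrightarrow> P b = f b"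
    using vec.linear_independent_extend[OF ext(1), of f] by blast
  have axes: "vec.independent (cart_basis :: (complex ^ 'n) set)"
    by (rule vec.independent_Basis)
  have PC: "P ` C \<subseteq> cart_basis" and "inj_on P C"
    using P(2) \<iota> by (auto simp: f_def cart_basis_def inj_on_def axis_eq_axis)
  then have "vec.independent (P ` C)"
    using axes vec.independent_mono by blast
  then have inj: "inj_on P (vec.span C)"
    using vec.linear_inj_on_span_independent_image[OF P(1)] \<open>inj_on P C\<close> by blast
  have PB: "P y = 0" if "y \<in> vec.span B" for y
    using that
  proof (induction rule: vec.span_induct)
    case base
    show ?case
      using P(1) vec.linear_subspace_kernel by auto
  next
    case (step b)
    then show ?case
      using P(2)[of b] fin(3) by (auto simp: f_def)
  qed
  have split: "\<exists>x y. z = x + y \<and> x \<in> vec.span C \<and> y \<in> vec.span B" for z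
    using vec.span_Un[of C B] ext(2) by blast
  have "P z = 0 \<longleftrightarrow> z \<in> Q" for z
  proof
    assume "P z = 0"
    obtain x y where z: "z = x + y" "x \<in> vec.span C" "y \<in> vec.span B"
      using split by blast
    then have "P x = P 0"
      using \<open>P z = 0\<close> PB[of y] vec.linear_add[OF P(1)] vec.linear_0[OF P(1)] by simp
    then have "x = 0"
      using inj z(2) vec.span_zero by (auto dest: inj_onD)
    then show "z \<in> Q"
      using z spanB by simp
  qed (use PB spanB in blast)
  moreover have "range P \<subseteq> vec.span (P ` C)"
  proof
    fix u assume "u \<in> range P"
    then obtain z where "u = P z" by blast
    moreover obtain x y where z: "z = x + y" "x \<in> vec.span C" "y \<in> vec.span B"
      using split by blast
    ultimately have "u = P x"
      using PB[of y] vec.linear_add[OF P(1)] by simp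
    then show "u \<in> vec.span (P ` C)"
      using z vec.linear_span_image[OF P(1)] by blast
  qed
  have "card (P ` C) < CARD('n)"
    using card_image_le[OF fin(2), of P] cardC by linarith
  then have "vec.dim (vec.span (P ` C)) < CARD('n)"
    using vec.dim_le_card[of "vec.span (P ` C)" "P ` C"] fin(2) by simp
  then have "vec.span (P ` C) \<noteq> UNIV"
    by (metis less_irrefl vec.dim_UNIV card_cart_basis)
  ultimately show ?thesis
    using that P(1) \<open>range P \<subseteq> vec.span (P ` C)\<close> by blast
qed

text \<open>
  Fewer equations than unknowns never have an isolated solution. Writing \<open>Q\<close> as the kernel of a map \<open>P\<close>
  that misses a vector \<open>e\<close>, the map \<open>P \<circ> \<Psi> - \<epsilon> e\<close> vanishes nowhere. If \<open>0\<close> were the only point over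
  \<open>Q\<close>, then for small \<open>\<epsilon>\<close> this map would be large on a sphere and small at the centre, against the
  minimum modulus principle.
\<close>

theorem no_isolated_point_in_preimage_of_subspace:
  fixes \<Psi> :: "complex ^ 'n \<Rightarrow> complex ^ 'm"
  assumes U: "open U" "0 \<in> U" and \<Psi>: "holomorphic_map_on \<Psi> U"
    and Q: "vec.subspace Q" "\<Psi> 0 \<in> Q" and dim: "CARD('m) < vec.dim Q + CARD('n)"
  obtains z where "z \<in> U" "z \<noteq> 0" "\<Psi> z \<in> Q"
proof (rule ccontr)
  assume "\<not> thesis"
  with that have iso: "\<And>z. z \<in> U \<Longrightarrow> \<Psi> z \<in> Q \<Longrightarrow> z = 0"
    by blast
  obtain P :: "complex ^ 'm \<Rightarrow> complex ^ 'n" and e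
    where P: "clinear_map P" and ker: "\<And>x. P x = 0 \<longleftrightarrow> x \<in> Q" and e: "e \<notin> range P"
    using linear_map_with_kernel[OF Q(1) dim] by blast
  obtain r where r: "r > 0" "cball 0 r \<subseteq> U"
    using U open_contains_cball by blast
  have "linear P"
    using P by (intro linearI) (simp_all add: vec.linear_add vec.linear_scale scaleR_eq_complex_scale)
  then have contP: "bounded_linear P"
    by (simp add: linear_conv_bounded_linear)
  have "isCont \<Psi> z" if "z \<in> U" for z
    using that \<Psi> has_derivative_continuous unfolding holomorphic_map_on_def by blast
  then have "continuous_on (sphere 0 r) \<Psi>"
    using r by (intro continuous_at_imp_continuous_on) auto
  then have cont: "continuous_on (sphere 0 r) (\<lambda>z. norm (P (\<Psi> z)))"
    using bounded_linear.continuous_on[OF contP] continuous_on_norm by blast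
  have "sphere (0 :: complex ^ 'n) r \<noteq> {}"
    using r by simp
  then obtain z0 where z0: "z0 \<in> sphere 0 r"
      "\<And>z. z \<in> sphere 0 r \<Longrightarrow> norm (P (\<Psi> z0)) \<le> norm (P (\<Psi> z))"
    using continuous_attains_inf[OF compact_sphere _ cont] by blast
  define c where "c = norm (P (\<Psi> z0))"
  have "c > 0"
    using iso[of z0] z0(1) r by (auto simp: c_def ker)
  have "e \<noteq> 0"
    using e vec.linear_0[OF P] by (metis rangeI)
  \<comment> \<open>The shift then has norm \<open>c / 3\<close>, so the map has norm \<open>c / 3\<close> at \<open>0\<close> and at least \<open>2 c / 3\<close> on the
      sphere.\<close>
  define \<epsilon> where "\<epsilon> = c / (3 * norm e)"
  have \<epsilon>: "\<epsilon> > 0" "norm (\<epsilon> *\<^sub>R e) = c / 3"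
    using \<open>c > 0\<close> \<open>e \<noteq> 0\<close> by (simp_all add: \<epsilon>_def)
  define F where "F = (\<lambda>z. P (\<Psi> z) - \<epsilon> *\<^sub>R e)"
  have "c - c / 3 \<le> norm (F 0)"
  proof (rule minimum_modulus_principle[OF U(1) r(2)])
    show "holomorphic_map_on F U"
      unfolding holomorphic_map_on_def
    proof (intro ballI)
      fix z assume "z \<in> U"
      then obtain D where D: "clinear_map D" "(\<Psi> has_derivative D) (at z)"
        using \<Psi> unfolding holomorphic_map_on_def by blast
      have "(F has_derivative (\<lambda>u. P (D u) - 0)) (at z)"
        unfolding F_def
        by (intro has_derivative_diff has_derivative_const bounded_linear.has_derivative[OF contP] D)
      moreover have "clinear_map (\<lambda>u. P (D u) - 0)"
        using Vector_Spaces.linear_compose[OF D(1) P] by (simp add: o_def)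
      ultimately show "\<exists>f'. clinear_map f' \<and> (F has_derivative f') (at z)"
        by blast
    qed
    show "F z \<noteq> 0" for z
    proof
      assume "F z = 0"
      then have "e = P ((1 / \<epsilon>) *\<^sub>R \<Psi> z)"
        using \<epsilon>(1) linear_scale[OF \<open>linear P\<close>] by (simp add: F_def)
      then show False using e by blast
    qed
    show "c - c / 3 \<le> norm (F z)" if "z \<in> sphere 0 r" for z
      using z0(2)[OF that] norm_triangle_ineq2[of "P (\<Psi> z)" "\<epsilon> *\<^sub>R e"] \<epsilon>(2)
      by (simp add: F_def c_def)
  qed (use r in simp)
  also have "norm (F 0) = c / 3"
    using ker[of "\<Psi> 0"] Q(2) \<epsilon>(2) by (simp add: F_def)
  finally show False
    using \<open>c > 0\<close> by simp
qed

lemma clinear_map_imp_linear: "clinear_map f \<Longrightarrow> linear f"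
  by (intro linearI) (simp_all add: vec.linear_add vec.linear_scale scaleR_eq_complex_scale)

section \<open>Elements of a reflection group with small fixed space\<close>

context
  fixes H :: "complex ^ 'p \<Rightarrow> complex ^ 'p \<Rightarrow> complex"
  assumes H: "pos_def_hermitian H"
begin

lemma form_linear: "clinear_form (\<lambda>v. H v w)"
  using H unfolding pos_def_hermitian_def by blast

lemma form_diff: "H (u - v) w = H u w - H v w"
  using module_hom.diff[OF Vector_Spaces.linear.axioms(3)[OF form_linear]] .

lemma form_commute: "H w v = cnj (H v w)"
  using H unfolding pos_def_hermitian_def by blast

lemma form_eq_0_commute:
  assumes "H v w = 0"
  shows "H w v = 0"
  unfolding form_commute[of w v] assms by (rule complex_cnj_zero)

lemma form_definite: "H v v = 0 \<Longrightarrow> v = 0"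
proof (rule ccontr)
  assume "H v v = 0" "v \<noteq> 0"
  moreover have "v \<noteq> 0 \<longrightarrow> Re (H v v) > 0"
    using H unfolding pos_def_hermitian_def by blast
  ultimately show False by (simp only: zero_complex.sel less_irrefl simp_thms)
qed

lemma subspace_form_kernel: "vec.subspace {v. H v w = 0}"
  using module_hom.subspace_kernel[OF Vector_Spaces.linear.axioms(3)[OF form_linear]] .

lemma span_orthogonal:
  assumes "\<And>v. v \<in> S \<Longrightarrow> H v w = 0" "v \<in> vec.span S"
  shows "H v w = 0"
proof -
  have "vec.span S \<subseteq> {v. H v w = 0}"
    using assms(1) by (intro vec.span_minimal subspace_form_kernel subsetI) simp
  then show ?thesis using assms(2) by blast
qed

lemma displacement_orthogonal_to_fixed_space:
  assumes "unitary_map H g" "u \<in> fixed_space g"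
  shows "H (g v - v) u = 0"
proof -
  have "H (g v) (g u) = H v u"
    using assms(1) by (simp add: unitary_map_def)
  moreover have "g u = u"
    using assms(2) by (simp add: fixed_space_def)
  ultimately show ?thesis by (simp only: form_diff diff_self)
qed

lemma subspace_fixed_space:
  assumes "unitary_map H g"
  shows "vec.subspace (fixed_space g)"
  using assms unfolding unitary_map_def fixed_space_def vec.subspace_def
  by (auto simp: vec.linear_0 vec.linear_add vec.linear_scale)

text \<open>
  If \<open>s (g v) = v\<close>, the displacement \<open>g v - v\<close> is orthogonal both to the fixed space of \<open>g\<close> and, being
  also a displacement of \<open>s\<close> up to sign, to that of \<open>s\<close>. The latter is a hyperplane that does not contain the
  former, so together they span everything and the displacement vanishes.
\<close>

lemma fixed_space_reflection_comp:
  assumes s: "is_reflection H s" and g: "unitary_map H g"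
    and not_sub: "\<not> fixed_space g \<subseteq> fixed_space s"
  shows "fixed_space (s \<circ> g) = fixed_space g \<inter> fixed_space s"
proof (intro equalityI subsetI)
  fix v assume "v \<in> fixed_space (s \<circ> g)"
  then have sgv: "s (g v) = v" by (simp add: fixed_space_def)
  have s': "unitary_map H s" and dim_s: "vec.dim (fixed_space s) + 1 = CARD('p)"
    using s by (simp_all add: is_reflection_def)
  define S where "S = vec.span (fixed_space s \<union> fixed_space g)"
  have "vec.dim (fixed_space s) < vec.dim S"
  proof (rule vec.dim_psubset)
    have "vec.span (fixed_space s) = fixed_space s"
      using subspace_fixed_space[OF s'] by (simp add: vec.span_eq_iff)
    moreover have "fixed_space s \<union> fixed_space g \<subseteq> S"
      unfolding S_def by (rule vec.span_superset)
    ultimately show "vec.span (fixed_space s) \<subset> vec.span S"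
      using not_sub unfolding S_def vec.span_span by blast
  qed
  then have "vec.dim S = CARD('p)"
    using dim_s dim_subset_UNIV_cart_gen[of S] by linarith
  then have "S = UNIV"
    using vec.dim_eq_full[of S] vec_dim_card[where 'a = complex and 'n = 'p]
    by (simp only: S_def vec.span_span vec.dim_UNIV vec.dimension_def simp_thms)
  have "H u (g v - v) = 0" if "u \<in> fixed_space s \<union> fixed_space g" for u
    using that
  proof
    assume "u \<in> fixed_space s"
    from displacement_orthogonal_to_fixed_space[OF s' this, of "g v"]
    have "H (g v - v) u = 0"
      by (simp add: sgv form_diff)
    then show ?thesis by (rule form_eq_0_commute)
  next
    assume "u \<in> fixed_space g"
    from displacement_orthogonal_to_fixed_space[OF g this]
    show ?thesis by (rule form_eq_0_commute)
  qed
  then have "H (g v - v) (g v - v) = 0"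
    using span_orthogonal[of "fixed_space s \<union> fixed_space g" "g v - v" "g v - v"] \<open>S = UNIV\<close>
    by (simp add: S_def)
  then have "g v = v"
    using form_definite[of "g v - v"] by simp
  then show "v \<in> fixed_space g \<inter> fixed_space s"
    using sgv by (simp only: fixed_space_def Int_iff mem_Collect_eq)
next
  fix v assume "v \<in> fixed_space g \<inter> fixed_space s"
  then have "g v = v" "s v = v" by (simp_all only: fixed_space_def Int_iff mem_Collect_eq)
  then have "s (g v) = v" by (simp only:)
  then show "v \<in> fixed_space (s \<circ> g)"
    by (simp only: fixed_space_def mem_Collect_eq o_apply)
qed

text \<open>
  An element with fixed space of least dimension will do: composing it with a reflection whose mirror does
  not contain this fixed space would cut it down further.
\<close>

lemma element_fixing_only_common_fixed_space:
  assumes G: "subgroup G (unitary_group H)"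
  obtains g where "g \<in> G"
    "\<And>s. s \<in> G \<Longrightarrow> is_reflection H s \<Longrightarrow> fixed_space g \<subseteq> fixed_space s"
proof -
  have unitary: "unitary_map H g" if "g \<in> G" for g
    using subgroup.subset[OF G] that by (auto simp: unitary_group_def)
  have "id \<in> G"
    using subgroup.one_closed[OF G] by (simp add: unitary_group_def)
  then obtain g where g: "g \<in> G"
    and least: "\<And>k. k \<in> G \<Longrightarrow> vec.dim (fixed_space g) \<le> vec.dim (fixed_space k)"
    using ex_has_least_nat[of "\<lambda>g. g \<in> G" id "\<lambda>g. vec.dim (fixed_space g)"] by blast
  have "fixed_space g \<subseteq> fixed_space s" if s: "s \<in> G" "is_reflection H s" for s
  proof (rule ccontr)
    assume not_sub: "\<not> fixed_space g \<subseteq> fixed_space s"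
    have eq: "fixed_space (s \<circ> g) = fixed_space g \<inter> fixed_space s"
      using fixed_space_reflection_comp[OF s(2) unitary[OF g] not_sub] .
    have sg: "s \<circ> g \<in> G"
      using subgroup.m_closed[OF G s(1) g] by (simp add: unitary_group_def)
    have span: "vec.span (fixed_space k) = fixed_space k" if "k \<in> G" for k
      using subspace_fixed_space[OF unitary[OF that]] by (simp only: vec.span_eq_iff)
    have "vec.span (fixed_space (s \<circ> g)) \<subset> vec.span (fixed_space g)"
      unfolding span[OF sg] span[OF g] unfolding eq using not_sub by blast
    from vec.dim_psubset[OF this] least[OF sg] show False
      by simp
  qed
  then show ?thesis using that g by blast
qed

text \<open>
  The subspace \<open>K\<close> is the intersection of a mirror with the span \<open>R\<close> of all roots (the vectors orthogonal to
  some mirror); it has codimension at most one in \<open>R\<close>. A vector fixed by the element \<open>g\<close> of the previous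
  lemma lies in all mirrors, hence is orthogonal to \<open>R\<close>; if it also lies in \<open>R\<close> it is orthogonal to itself.
\<close>

lemma moved_subspace_of_hyperplane:
  assumes G: "subgroup G (unitary_group H)" and rank: "reflection_rank H G > 0"
  obtains g s K where "g \<in> G" "s \<in> G" "is_reflection H s"
    "vec.subspace K" "K \<subseteq> fixed_space s" "K \<inter> fixed_space g \<subseteq> {0}"
    "reflection_rank H G \<le> vec.dim K + 1"
proof -
  define roots where "roots = (\<Union>s\<in>{s\<in>G. is_reflection H s}. orth_compl H (fixed_space s))"
  define R where "R = vec.span roots"
  have rank_eq: "reflection_rank H G = vec.dim R"
    by (simp add: reflection_rank_def R_def roots_def)
  have "{s \<in> G. is_reflection H s} \<noteq> {}"
  proof
    assume "{s \<in> G. is_reflection H s} = {}"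
    then have "roots = {}" unfolding roots_def by (simp only: UN_empty)
    then show False
      using rank by (simp add: rank_eq R_def del: vec.dim_span)
  qed
  then obtain s where s: "s \<in> G" "is_reflection H s" by blast
  then have s': "unitary_map H s" "vec.dim (fixed_space s) + 1 = CARD('p)"
    by (simp_all add: is_reflection_def)
  obtain g where g: "g \<in> G"
    and g_least: "\<And>s. s \<in> G \<Longrightarrow> is_reflection H s \<Longrightarrow> fixed_space g \<subseteq> fixed_space s"
    using element_fixing_only_common_fixed_space[OF G] by blast
  have R: "vec.subspace R"
    by (simp add: R_def)
  have "vec.dim {x + y |x y. x \<in> fixed_space s \<and> y \<in> R} + vec.dim (fixed_space s \<inter> R)
      = vec.dim (fixed_space s) + vec.dim R"
    using vec.dim_sums_Int[OF subspace_fixed_space[OF s'(1)] R] .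
  moreover have "vec.dim {x + y |x y. x \<in> fixed_space s \<and> y \<in> R} \<le> CARD('p)"
    by (rule dim_subset_UNIV_cart_gen)
  ultimately have "vec.dim R \<le> vec.dim (fixed_space s \<inter> R) + 1"
    using s'(2) by linarith
  moreover have "v = 0" if v: "v \<in> R" "v \<in> fixed_space g" for v
  proof -
    have "H a v = 0" if "a \<in> roots" for a
      using that v(2) g_least unfolding roots_def orth_compl_def by blast
    then have "H v v = 0"
      using span_orthogonal[of roots v v] v(1) by (simp add: R_def)
    then show ?thesis by (rule form_definite)
  qed
  then have "fixed_space s \<inter> R \<inter> fixed_space g \<subseteq> {0}" by blast
  ultimately show ?thesis
    using that[OF g s vec.subspace_inter[OF subspace_fixed_space[OF s'(1)] R]] rank_eq by simp
qed

end

section \<open>Critical points of the orbit map\<close>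

lemma polynomial_functions_differentiable:
  assumes "P \<in> polynomial_functions"
  shows "P differentiable at v"
  using assms unfolding polynomial_functions_def
proof (induction rule: algebra_generated.induct)
  case (gen L)
  then have L: "clinear_form L" by simp
  have "linear L"
  proof (rule linearI)
    show "L (x + y) = L x + L y" for x y
      using module_hom.add[OF Vector_Spaces.linear.axioms(3)[OF L]] .
    show "L (c *\<^sub>R x) = c *\<^sub>R L x" for c x
      using module_hom.scale[OF Vector_Spaces.linear.axioms(3)[OF L]]
      by (simp add: scaleR_eq_complex_scale scaleR_conv_of_real)
  qed
  then show ?case
    by (simp add: linear_imp_differentiable)
qed (auto intro: differentiable_add differentiable_mult)

context
  fixes G :: "(complex ^ 'p \<Rightarrow> complex ^ 'p) set" and \<omega> :: "complex ^ 'p \<Rightarrow> complex ^ 'p"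
  assumes \<omega>: "orbit_map G \<omega>"
begin

lemma orbit_map_coordinate: "(\<lambda>v. \<omega> v $ i) \<in> invariant_polynomials G"
proof -
  have "(\<lambda>v. \<omega> v $ i) \<in> algebra_generated (range (\<lambda>i v. \<omega> v $ i))"
    by (rule algebra_generated.gen) blast
  then show ?thesis
    using \<omega> by (simp add: orbit_map_def)
qed

lemma orbit_map_invariant: "g \<in> G \<Longrightarrow> \<omega> (g v) = \<omega> v"
  using orbit_map_coordinate by (simp add: invariant_polynomials_def vec_eq_iff)

lemma orbit_map_differentiable: "\<omega> differentiable at v"
proof -
  have "(\<lambda>v. (\<omega> v $ i) *s axis i 1) differentiable at v" for i
  proof -
    have "(\<lambda>v. \<omega> v $ i) differentiable at v"
      using orbit_map_coordinate polynomial_functions_differentiable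
      unfolding invariant_polynomials_def by blast
    then show ?thesis
      using bounded_linear.has_derivative[OF bounded_linear_cscale_left]
      unfolding differentiable_def by blast
  qed
  then have "(\<lambda>v. \<Sum>i\<in>UNIV. (\<omega> v $ i) *s axis i 1) differentiable at v"
    by (intro differentiable_sum) auto
  then show ?thesis
    by (simp only: basis_expansion)
qed

lemma orbit_map_derivative_invariant:
  assumes g: "g \<in> G" "clinear_map g"
    and D: "(\<omega> has_derivative D) (at v)" "(\<omega> has_derivative D') (at (g v))"
  shows "D u = D' (g u)"
proof -
  have "(g has_derivative g) (at v)"
    using clinear_map_imp_linear[OF g(2)] by (simp add: linear_imp_has_derivative)
  from has_derivative_compose[OF this D(2)]
  have "(\<omega> has_derivative (\<lambda>u. D' (g u))) (at v)"
    by (simp add: orbit_map_invariant[OF g(1)])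
  then show ?thesis
    using has_derivative_unique[OF D(1)] by metis
qed

text \<open>
  Differentiating \<open>\<omega> \<circ> s = \<omega>\<close> at the fixed point \<open>v\<close> gives \<open>D (s u) = D u\<close>. Since \<open>s\<close> moves some vector, \<open>D\<close>
  is not injective, and therefore not onto.
\<close>

lemma orbit_map_critical_on_hyperplane:
  assumes s: "s \<in> G" "clinear_map s" "s \<noteq> id" "s v = v"
    and D: "(\<omega> has_derivative D) (at v)"
  shows "range D \<noteq> UNIV"
proof
  assume "surj D"
  have "linear D"
    using D has_derivative_linear by blast
  then have "inj D"
    using \<open>surj D\<close> linear_surjective_imp_injective by blast
  have D': "(\<omega> has_derivative D) (at (s v))"
    unfolding s(4) by (rule D)
  have "s u = u" for u
    using injD[OF \<open>inj D\<close> orbit_map_derivative_invariant[OF s(1,2) D D', of u]] by (rule sym)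
  then show False
    using s(3) by auto
qed

end

section \<open>Double points and normal crossings\<close>

text \<open>
  Transversality for \<open>k = 2\<close> at the pair \<open>(x, x')\<close>, applied to the tangent vector \<open>(y, 0)\<close>: subtracting the
  two components eliminates the summand in the diagonal.
\<close>

lemma derivatives_span_at_double_point:
  fixes f :: "complex ^ 'n \<Rightarrow> complex ^ 'p"
  assumes nc: "normal_crossings_on U f" and x: "x \<in> U" "x' \<in> U" "x \<noteq> x'" "f x = f x'"
    and D: "(f has_derivative D) (at x)" "(f has_derivative D') (at x')"
  obtains u u' where "y = D u - D' u'"
proof -
  define z where "z = (\<lambda>i\<in>{..<2::nat}. if i = 0 then x else x')"
  define t where "t = (\<lambda>i\<in>{..<2::nat}. if i = 0 then y else 0)"
  have less_2: "i < 2 \<longleftrightarrow> i = 0 \<or> i = 1" for i :: nat by auto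
  have "z \<in> distinct_power U 2"
    using x by (auto simp: z_def distinct_power_def cart_power_def less_2)
  moreover have "power_map 2 f z \<in> small_diagonal UNIV 2"
    using x by (auto simp: z_def power_map_def small_diagonal_def cart_power_def less_2)
  ultimately have "{(\<lambda>i\<in>{..<2}. a i + b i) | a b.
        a \<in> power_differential 2 f z ` cart_power UNIV 2 \<and> b \<in> small_diagonal UNIV 2}
      = cart_power UNIV 2"
    using nc unfolding normal_crossings_on_def transverse_to_diagonal_def by blast
  moreover have "t \<in> cart_power UNIV 2"
    by (auto simp: t_def cart_power_def)
  ultimately obtain u b where t: "t = (\<lambda>i\<in>{..<2}. power_differential 2 f z u i + b i)"
    and b: "b \<in> small_diagonal UNIV 2"
    by blast
  have "frechet_derivative f (at x) = D" "frechet_derivative f (at x') = D'"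
    using frechet_derivative_at[OF D(1)] frechet_derivative_at[OF D(2)] by simp_all
  then have "y = D (u 0) + b 0" "0 = D' (u 1) + b 1"
    using fun_cong[OF t, of 0] fun_cong[OF t, of 1]
    by (simp_all add: t_def z_def power_differential_def)
  moreover have "b 0 = b 1"
    using b by (simp add: small_diagonal_def)
  ultimately have "y = D (u 0) - D' (u 1)"
    by (metis add.inverse_unique diff_minus_eq_add minus_minus add.commute)
  then show ?thesis by (rule that)
qed

lemma unitary_map_surj:
  assumes H: "pos_def_hermitian H" and g: "unitary_map H g"
  shows "surj g"
proof -
  have lin: "clinear_map g" and pres: "\<And>v w. H (g v) (g w) = H v w"
    using g by (simp_all add: unitary_map_def)
  have "v = 0" if "g v = 0" for v
  proof (rule form_definite[OF H])
    have "H v v = H (g v - g v) (g v)"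
      using that pres[of v v] by simp
    then show "H v v = 0"
      by (simp only: form_diff[OF H] diff_self[of "H (g v) (g v)"])
  qed
  then have "inj g"
    using vec.linear_inj_iff_eq_0[OF lin] by blast
  then show ?thesis
    using vec.linear_inj_imp_surj[OF lin] by blast
qed

text \<open>
  The derivative of \<open>f\<close> at each of the two points factors through the derivative of \<open>\<omega>\<close>, at \<open>h x\<close> and at
  \<open>g (h x)\<close>. Invariance of \<open>\<omega>\<close> under \<open>g\<close> gives these two derivatives of \<open>\<omega>\<close> the same range, so if \<open>x\<close> and
  \<open>x'\<close> were distinct, normal crossings would force this range to be everything. On a mirror it is not.
\<close>

lemma double_point_off_mirrors:
  fixes f h :: "complex ^ 'n \<Rightarrow> complex ^ 'p"
  assumes H: "pos_def_hermitian H" and \<omega>: "orbit_map G \<omega>"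
    and U: "open U" and h: "holomorphic_map_on h U" and f: "\<And>x. x \<in> U \<Longrightarrow> f x = \<omega> (h x)"
    and nc: "normal_crossings_on U' f" "U \<subseteq> U'"
    and g: "g \<in> G" "unitary_map H g" and s: "s \<in> G" "is_reflection H s"
    and x: "x \<in> U" "x' \<in> U" "h x' = g (h x)" "h x \<in> fixed_space s"
  shows "x = x'"
proof (rule ccontr)
  assume "x \<noteq> x'"
  have lin_g: "clinear_map g" and lin_s: "clinear_map s"
    using g s by (simp_all add: unitary_map_def is_reflection_def)
  have "s \<noteq> id"
  proof
    assume "s = id"
    then have "fixed_space s = UNIV" by (simp add: fixed_space_def)
    then show False
      using s(2) vec_dim_card[where 'a = complex and 'n = 'p] by (simp add: is_reflection_def)
  qed
  obtain D where D: "(\<omega> has_derivative D) (at (h x))"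
    using orbit_map_differentiable[OF \<omega>] unfolding differentiable_def by blast
  obtain D' where D': "(\<omega> has_derivative D') (at (g (h x)))"
    using orbit_map_differentiable[OF \<omega>] unfolding differentiable_def by blast
  have f_deriv: "\<exists>k. (f has_derivative (\<lambda>u. E (k u))) (at a)"
    if "a \<in> U" "(\<omega> has_derivative E) (at (h a))" for a E
  proof -
    obtain k where k: "(h has_derivative k) (at a)"
      using h \<open>a \<in> U\<close> unfolding holomorphic_map_on_def by blast
    have "(f has_derivative (\<lambda>u. E (k u))) (at a)"
      by (rule has_derivative_transform_within_open[OF has_derivative_compose[OF k that(2)] U \<open>a \<in> U\<close>])
        (simp add: f)
    then show ?thesis by blast
  qed
  obtain k where k: "(f has_derivative (\<lambda>u. D (k u))) (at x)"
    using f_deriv[OF x(1) D] by blast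
  obtain k' where k': "(f has_derivative (\<lambda>u. D' (k' u))) (at x')"
    using f_deriv[OF x(2), of D'] D' x(3) by auto
  have fx: "f x = f x'"
    using f x orbit_map_invariant[OF \<omega> g(1)] by simp
  have "y \<in> range D" for y
  proof -
    obtain u u' where y: "y = D (k u) - D' (k' u')"
      using derivatives_span_at_double_point[OF nc(1) _ _ \<open>x \<noteq> x'\<close> fx k k'] x nc(2) by blast
    obtain w where "k' u' = g w"
      using unitary_map_surj[OF H g(2)] by (rule surjE)
    then have "y = D (k u) - D w"
      using y orbit_map_derivative_invariant[OF \<omega> g(1) lin_g D D'] by simp
    also have "\<dots> = D (k u - w)"
      using D has_derivative_linear linear_diff by metis
    finally show ?thesis by blast
  qed
  moreover have "s (h x) = h x"
    using x(4) by (simp add: fixed_space_def)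
  ultimately show False
    using orbit_map_critical_on_hyperplane[OF \<omega> s(1) lin_s \<open>s \<noteq> id\<close> _ D] by blast
qed

section \<open>Coordinates on a product\<close>

definition left_part :: "complex ^ ('a::finite + 'b::finite) \<Rightarrow> complex ^ 'a::finite" where
  "left_part z = (\<chi> i. z $ Inl i)"

definition right_part :: "complex ^ ('a::finite + 'b::finite) \<Rightarrow> complex ^ 'b" where
  "right_part z = (\<chi> i. z $ Inr i)"

definition join :: "complex ^ 'a \<Rightarrow> complex ^ 'b \<Rightarrow> complex ^ ('a::finite + 'b::finite)" where
  "join x y = (\<chi> i. case i of Inl j \<Rightarrow> x $ j | Inr j \<Rightarrow> y $ j)"

lemma left_part_join [simp]: "left_part (join x y) = x"
  and right_part_join [simp]: "right_part (join x y) = y"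
  and join_parts [simp]: "join (left_part z) (right_part z) = z"
  by (simp_all add: left_part_def right_part_def join_def vec_eq_iff split: sum.split)

lemma clinear_mapI:
  assumes "\<And>x y. f (x + y) = f x + f y" "\<And>c x. f (c *s x) = c *s f x"
  shows "clinear_map f"
  using assms by (simp add: Vector_Spaces.linear_iff vec.vector_space_axioms)

lemma clinear_map_left_part: "clinear_map left_part"
  and clinear_map_right_part: "clinear_map right_part"
  by (rule clinear_mapI; simp add: left_part_def right_part_def vec_eq_iff)+

lemma clinear_map_join:
  assumes "clinear_map f" "clinear_map g"
  shows "clinear_map (\<lambda>x. join (f x) (g x))"
  by (rule clinear_mapI)
    (simp_all add: join_def vec_eq_iff vec.linear_add[OF assms(1)] vec.linear_add[OF assms(2)]
      vec.linear_scale[OF assms(1)] vec.linear_scale[OF assms(2)] split: sum.split)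

lemma clinear_map_has_derivative:
  "clinear_map f \<Longrightarrow> (f has_derivative f) (at x)"
  by (simp add: clinear_map_imp_linear linear_imp_has_derivative)

lemma holomorphic_map_on_join:
  assumes "holomorphic_map_on f U" "holomorphic_map_on g U"
  shows "holomorphic_map_on (\<lambda>x. join (f x) (g x)) U"
  unfolding holomorphic_map_on_def
proof (intro ballI)
  fix x assume "x \<in> U"
  then obtain f' g' where f': "clinear_map f'" "(f has_derivative f') (at x)"
    and g': "clinear_map g'" "(g has_derivative g') (at x)"
    using assms unfolding holomorphic_map_on_def by meson
  have lin: "clinear_map (\<lambda>y. join y 0)" "clinear_map (\<lambda>y. join 0 y)"
    by (rule clinear_mapI; simp add: join_def vec_eq_iff split: sum.split)+
  have sum: "join y w = join y 0 + join 0 w" for y w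
    by (simp add: join_def vec_eq_iff split: sum.split)
  have "((\<lambda>x. join (f x) 0 + join 0 (g x)) has_derivative
      (\<lambda>u. join (f' u) 0 + join 0 (g' u))) (at x)"
    by (intro has_derivative_add has_derivative_compose[OF f'(2)] has_derivative_compose[OF g'(2)]
        clinear_map_has_derivative lin)
  then have "((\<lambda>x. join (f x) (g x)) has_derivative (\<lambda>u. join (f' u) (g' u))) (at x)"
    by (simp only: sum[symmetric])
  then show "\<exists>D. clinear_map D \<and> ((\<lambda>x. join (f x) (g x)) has_derivative D) (at x)"
    using clinear_map_join[OF f'(1) g'(1)] by blast
qed

lemma holomorphic_map_on_comp_linear:
  assumes f: "holomorphic_map_on f U" and L: "clinear_map L"
  shows "holomorphic_map_on (\<lambda>x. f (L x)) (L -` U)"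
  unfolding holomorphic_map_on_def
proof (intro ballI)
  fix x assume "x \<in> L -` U"
  then obtain f' where f': "clinear_map f'" "(f has_derivative f') (at (L x))"
    using f unfolding holomorphic_map_on_def by blast
  have "((\<lambda>x. f (L x)) has_derivative (\<lambda>u. f' (L u))) (at x)"
    by (rule has_derivative_compose[OF clinear_map_has_derivative[OF L] f'(2)])
  moreover have "clinear_map (\<lambda>u. f' (L u))"
    using Vector_Spaces.linear_compose[OF L f'(1)] by (simp add: o_def)
  ultimately show "\<exists>D. clinear_map D \<and> ((\<lambda>x. f (L x)) has_derivative D) (at x)"
    by blast
qed

lemma open_linear_vimage:
  assumes "clinear_map L" "open U"
  shows "open (L -` U)"
  using assms(2)
  by (rule open_vimage)
    (simp add: linear_continuous_on linear_conv_bounded_linear[symmetric]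
      clinear_map_imp_linear[OF assms(1)])

section \<open>The bound on the rank\<close>

text \<open>
  A dimension count for pairs \<open>(x, x')\<close> with \<open>h x = k\<close> and \<open>h x' = g k\<close> for some \<open>k \<in> K\<close>, where \<open>K\<close> lies in a
  mirror and contains no nonzero vector fixed by \<open>g\<close>. There are \<open>2n\<close> unknowns and \<open>2p - dim K\<close> equations, where
  \<open>dim K \<ge> rank G - 1\<close>; a rank above the bound leaves fewer equations than unknowns, hence a nonzero solution.
  Normal crossings give \<open>x = x'\<close>, so \<open>g\<close> fixes \<open>k\<close>, so \<open>k = 0\<close>, and both points are the origin.
\<close>

lemma rank_bound:
  fixes f h :: "complex ^ 'n \<Rightarrow> complex ^ 'p"
  assumes H: "pos_def_hermitian H" and G: "subgroup G (unitary_group H)" and \<omega>: "orbit_map G \<omega>"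
    and U: "open U" "0 \<in> U" and h: "holomorphic_map_on h U" "h 0 = 0"
    and isolated: "\<And>x. x \<in> U \<Longrightarrow> h x = 0 \<Longrightarrow> x = 0"
    and f: "\<And>x. x \<in> U \<Longrightarrow> f x = \<omega> (h x)"
    and nc: "normal_crossings_on U' f" "U \<subseteq> U'"
  shows "int (reflection_rank H G) \<le> 2 * (int CARD('p) - int CARD('n)) + 1"
proof (rule ccontr)
  assume "\<not> ?thesis"
  then have "int (2 * CARD('p) + 2) \<le> int (reflection_rank H G + 2 * CARD('n))"
    by simp
  then have large: "2 * CARD('p) + 2 \<le> reflection_rank H G + 2 * CARD('n)"
    by (simp only: of_nat_le_iff)
  \<comment> \<open>Without this the rank could be zero, and there would be no mirror to work with.\<close>
  have "CARD('n) \<le> CARD('p)"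
  proof (rule ccontr)
    assume "\<not> CARD('n) \<le> CARD('p)"
    then have less: "CARD('p) < vec.dim {0 :: complex ^ 'p} + CARD('n)"
      by linarith
    obtain z where "z \<in> U" "z \<noteq> 0" "h z \<in> {0}"
      by (rule no_isolated_point_in_preimage_of_subspace[OF U h(1) vec.subspace_single_0 _ less])
        (use h(2) in auto)
    then show False
      using isolated by blast
  qed
  then have "reflection_rank H G > 0"
    using large by linarith
  then obtain g s K where g: "g \<in> G" and s: "s \<in> G" "is_reflection H s"
    and K: "vec.subspace K" "K \<subseteq> fixed_space s" "K \<inter> fixed_space g \<subseteq> {0}"
      "reflection_rank H G \<le> vec.dim K + 1"
    by (rule moved_subspace_of_hyperplane[OF H G])
  have unitary: "unitary_map H g"
    using subgroup.subset[OF G] g by (auto simp: unitary_group_def)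
  then have lin_g: "clinear_map g"
    by (simp add: unitary_map_def)
  define graph where "graph = (\<lambda>k. join (g k) k)"
  define Q where "Q = graph ` K"
  have lin_graph: "clinear_map graph"
    unfolding graph_def by (intro clinear_map_join lin_g vec.linear_ident)
  have "inj_on graph (vec.span K)"
    by (rule inj_on_inverseI[where g = right_part]) (simp add: graph_def)
  then have dim_Q: "vec.dim Q = vec.dim K"
    unfolding Q_def by (rule vec.dim_image_eq[OF lin_graph])
  have "vec.subspace Q"
    unfolding Q_def using lin_graph K(1) by (rule vec.linear_subspace_image)
  define \<Psi> :: "complex ^ ('n + 'n) \<Rightarrow> complex ^ ('p + 'p)"
    where "\<Psi> = (\<lambda>z. join (h (right_part z)) (h (left_part z)))"
  define V :: "(complex ^ ('n + 'n)) set" where "V = right_part -` U \<inter> left_part -` U"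
  have sub: "holomorphic_map_on k V" if "holomorphic_map_on k S" "V \<subseteq> S"
    for k :: "complex ^ ('n + 'n) \<Rightarrow> complex ^ 'p" and S
    using that unfolding holomorphic_map_on_def by blast
  have hol: "holomorphic_map_on \<Psi> V"
    unfolding \<Psi>_def
    by (intro holomorphic_map_on_join)
      (rule sub[OF holomorphic_map_on_comp_linear[OF h(1) clinear_map_right_part]]
        sub[OF holomorphic_map_on_comp_linear[OF h(1) clinear_map_left_part]];
        auto simp: V_def)+
  have V: "open V" "0 \<in> V"
    using U open_linear_vimage[OF clinear_map_right_part U(1)]
      open_linear_vimage[OF clinear_map_left_part U(1)]
    by (auto simp: V_def vec.linear_0[OF clinear_map_right_part] vec.linear_0[OF clinear_map_left_part])
  have "\<Psi> 0 = graph 0"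
    by (simp add: \<Psi>_def graph_def h(2) vec.linear_0[OF lin_g]
        vec.linear_0[OF clinear_map_right_part] vec.linear_0[OF clinear_map_left_part])
  then have "\<Psi> 0 \<in> Q"
    using vec.subspace_0[OF K(1)] by (simp add: Q_def)
  have "CARD('p + 'p) < vec.dim Q + CARD('n + 'n)"
    using large K(4) unfolding dim_Q card_UNIV_sum by simp
  then obtain z where z: "z \<in> V" "z \<noteq> 0" "\<Psi> z \<in> Q"
    using no_isolated_point_in_preimage_of_subspace[OF V hol \<open>vec.subspace Q\<close> \<open>\<Psi> 0 \<in> Q\<close>] by blast
  define x x' where "x = left_part z" and "x' = right_part z"
  have xU: "x \<in> U" "x' \<in> U"
    using z(1) by (simp_all add: V_def x_def x'_def)
  obtain k where k: "k \<in> K" "join (h x') (h x) = join (g k) k"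
    using z(3) by (auto simp: Q_def \<Psi>_def graph_def x_def x'_def)
  have hx: "h x = k" "h x' = g k"
    using arg_cong[OF k(2), of right_part] arg_cong[OF k(2), of left_part] by simp_all
  have "x = x'"
    by (rule double_point_off_mirrors[OF H \<omega> U(1) h(1) f nc g unitary s xU])
      (use hx k K(2) in auto)
  then have "k \<in> K \<inter> fixed_space g"
    using hx k(1) by (simp add: fixed_space_def)
  then have "x = 0"
    using K(3) hx isolated[OF xU(1)] by blast
  then have "join x x' = join 0 0"
    using \<open>x = x'\<close> by simp
  moreover have "join x x' = z"
    by (simp add: x_def x'_def)
  moreover have "join 0 0 = (0 :: complex ^ ('n + 'n))"
    by (simp add: join_def vec_eq_iff split: sum.split)
  ultimately show False
    using z(2) by simp
qed

theorem proposition5p13: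
  shows "\<not> (\<exists>(f :: complex ^ 'n \<Rightarrow> complex ^ 'p) H G \<omega> h.
              quasi_reflection_germ H G \<omega> h f \<and>
              germ_normal_crossings f \<and>
              int (reflection_rank H G) > 2 * (int CARD('p) - int CARD('n)) + 1)"
proof
  assume "\<exists>(f :: complex ^ 'n \<Rightarrow> complex ^ 'p) H G \<omega> h.
              quasi_reflection_germ H G \<omega> h f \<and>
              germ_normal_crossings f \<and>
              int (reflection_rank H G) > 2 * (int CARD('p) - int CARD('n)) + 1"
  then obtain f :: "complex ^ 'n \<Rightarrow> complex ^ 'p" and H G \<omega> h
    where qr: "quasi_reflection_germ H G \<omega> h f" and nc: "germ_normal_crossings f"
      and rank: "int (reflection_rank H G) > 2 * (int CARD('p) - int CARD('n)) + 1"
    by blast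
  from qr have H: "pos_def_hermitian H" and G: "subgroup G (unitary_group H)"
    and \<omega>: "orbit_map G \<omega>" and h: "finite_holomorphic_germ h"
    and f: "\<forall>\<^sub>F z in nhds 0. f z = \<omega> (h z)"
    by (auto simp: quasi_reflection_germ_def reflection_group_def)
  obtain U1 W h1 where h1: "open U1" "0 \<in> U1" "holomorphic_map_on h1 U1" "\<forall>\<^sub>F z in nhds 0. h1 z = h z"
    and fin: "finite_map U1 W h1" and "h 0 = 0"
    using h unfolding finite_holomorphic_germ_def holomorphic_representative_def by blast
  obtain f1 U2 where f1: "open U2" "0 \<in> U2" "\<forall>\<^sub>F z in nhds 0. f1 z = f z"
    and nc1: "normal_crossings_on U2 f1"
    using nc unfolding germ_normal_crossings_def holomorphic_representative_def by blast
  have h10: "h1 0 = 0"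
    using eventually_nhds_x_imp_x[OF h1(4)] \<open>h 0 = 0\<close> by simp
  define F where "F = {x \<in> U1. h1 x = 0} - {0}"
  have "0 \<in> W"
    using fin h1(2) h10 unfolding finite_map_def by force
  then have "finite F"
    using fin by (simp add: finite_map_def F_def)
  have "\<forall>\<^sub>F z in nhds 0. f1 z = \<omega> (h1 z)"
    using f f1(3) h1(4) by eventually_elim simp
  then obtain U3 where U3: "open U3" "0 \<in> U3" "\<And>z. z \<in> U3 \<Longrightarrow> f1 z = \<omega> (h1 z)"
    unfolding eventually_nhds by blast
  \<comment> \<open>Removing the finitely many other zeros of \<open>h1\<close> makes its zero at the origin the only one.\<close>
  define U where "U = (U1 \<inter> U2 \<inter> U3) - F"
  have U: "open U" "0 \<in> U"
    unfolding U_def using h1(1,2) f1(1,2) U3(1,2) finite_imp_closed[OF \<open>finite F\<close>]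
    by (auto simp: F_def intro!: open_Diff open_Int)
  have "int (reflection_rank H G) \<le> 2 * (int CARD('p) - int CARD('n)) + 1"
  proof (rule rank_bound[where f = f1 and h = h1 and U = U and U' = U2, OF H G \<omega> U _ h10 _ _ nc1])
    show "holomorphic_map_on h1 U"
      using h1(3) by (auto simp: U_def holomorphic_map_on_def)
  qed (use U3 in \<open>auto simp: U_def F_def\<close>)
  then show False
    using rank by linarith
qed

end
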